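(* Let $1\le k\le n$ and let $\Sigma\in\mathbb{S}^n$ with $\Sigma\succeq0$. Let $v^*$ be the optimal value of the sparse PCA problem $$\max_{x\in\mathbb{R}^n} x^T\Sigma x\quad\text{s.t. } \|x\|_0\le k,\ \|x\|_2^2=1,$$ and let $\bar v^*$ be the optimal value of the semidefinite program $$\max_{X\in\mathbb{S}^n}\Sigma\bullet X\quad\text{s.t. }\operatorname{Tr}(X)=1,\ X\in\mathcal{S}_{n,k}.$$ Then $$\frac{\bar v^*}{v^*}\le\min\{k,\;n/k,\;r\},$$ where $r=\operatorname{rank}(\Sigma)$.
   Context: $\mathbb{S}^n$ is the space of real symmetric $n\times n$ matrices, $A\bullet B=\operatorname{Tr}(B^TA)$, $A\succeq B$ means $A-B$ is positive semidefinite, $\operatorname{diag}(X)$ is the diagonal matrix with the same diagonal as $X$, $\|x\|_0$ is the number of nonzero entries of $x$, and $\mathcal{S}_{n,k}=\{X\in\mathbb{S}^n: k\operatorname{diag}(X)\succeq X\succeq 0\}$. *)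

theory Defs
  imports "HOL-Analysis.Analysis"
begin

definition sym_matrices :: "(real^'n^'n) set" where
  "sym_matrices = {A. transpose A = A}"

definition psd :: "real^'n^'n \<Rightarrow> bool" where
  "psd A \<longleftrightarrow> A \<in> sym_matrices \<and> (\<forall>x. 0 \<le> x \<bullet> (A *v x))"

definition loewner_ge :: "real^'n^'n \<Rightarrow> real^'n^'n \<Rightarrow> bool"  (infix "\<succeq>" 50) where
  "A \<succeq> B \<longleftrightarrow> psd (A - B)"

definition frob :: "real^'n^'n \<Rightarrow> real^'n^'n \<Rightarrow> real" where
  "frob A B = trace (transpose B ** A)"

definition diag_part :: "real^'n^'n \<Rightarrow> real^'n^'n" where
  "diag_part X = (\<chi> i j. if i = j then X $ i $ j else 0)"

definition l0 :: "real^'n \<Rightarrow> nat" where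
  "l0 x = card {i. x $ i \<noteq> 0}"

definition S_nk :: "nat \<Rightarrow> (real^'n^'n) set" where
  "S_nk k = {X \<in> sym_matrices. real k *\<^sub>R diag_part X \<succeq> X \<and> X \<succeq> 0}"

definition spca_feasible :: "nat \<Rightarrow> (real^'n) set" where
  "spca_feasible k = {x. l0 x \<le> k \<and> (norm x)\<^sup>2 = 1}"

definition sdp_feasible :: "nat \<Rightarrow> (real^'n^'n) set" where
  "sdp_feasible k = {X \<in> sym_matrices. trace X = 1 \<and> X \<in> S_nk k}"

text \<open>The two optimal values are suprema of real sets. The lemmas \<open>spca_value_attained\<close> and
  \<open>sdp_value_attained\<close> show that for \<open>k \<ge> 1\<close> both suprema are attained, so they are maxima.\<close>

definition spca_value :: "nat \<Rightarrow> real^'n^'n \<Rightarrow> real" where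
  "spca_value k \<Sigma> = (SUP x\<in>spca_feasible k. x \<bullet> (\<Sigma> *v x))"

definition sdp_value :: "nat \<Rightarrow> real^'n^'n \<Rightarrow> real" where
  "sdp_value k \<Sigma> = (SUP X\<in>sdp_feasible k. frob \<Sigma> X)"

lemma l0_axis: "l0 (axis i 1 :: real^'n) = 1"
proof -
  have "{j. (axis i 1 :: real^'n) $ j \<noteq> 0} = {i}" by (auto simp: axis_def)
  then show ?thesis by (simp add: l0_def)
qed

lemma spca_feasible_nonempty:
  assumes "1 \<le> k"
  shows "(spca_feasible k :: (real^'n) set) \<noteq> {}"
proof -
  have "(axis undefined 1 :: real^'n) \<in> spca_feasible k"
    using assms by (simp add: spca_feasible_def l0_axis norm_axis_1)
  then show ?thesis by blast
qed

lemma l0_le_iff: "l0 x \<le> k \<longleftrightarrow> (\<exists>S. card S \<le> k \<and> (\<forall>i. i \<notin> S \<longrightarrow> x $ i = 0))"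
proof
  assume "l0 x \<le> k"
  then show "\<exists>S. card S \<le> k \<and> (\<forall>i. i \<notin> S \<longrightarrow> x $ i = 0)"
    unfolding l0_def by (intro exI[of _ "{i. x $ i \<noteq> 0}"]) auto
next
  assume "\<exists>S. card S \<le> k \<and> (\<forall>i. i \<notin> S \<longrightarrow> x $ i = 0)"
  then obtain S where S: "card S \<le> k" "\<forall>i. i \<notin> S \<longrightarrow> x $ i = 0" by blast
  have "card {i. x $ i \<noteq> 0} \<le> card S" by (rule card_mono) (use S in auto)
  with S show "l0 x \<le> k" by (simp add: l0_def)
qed

lemma compact_spca_feasible: "compact (spca_feasible k :: (real^'n) set)"
proof -
  have "(spca_feasible k :: (real^'n) set) =
      (\<Union>S\<in>{S. card S \<le> k}. \<Inter>i\<in>-S. {x. x $ i = 0}) \<inter> sphere 0 1"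
    by (auto simp: spca_feasible_def l0_le_iff power2_eq_1_iff
        dest: order_trans[OF norm_ge_zero eq_refl])
  moreover have "closed (\<Union>S\<in>{S :: 'n set. card S \<le> k}. \<Inter>i\<in>-S. {x :: real^'n. x $ i = 0})"
    by (intro closed_UN closed_INT ballI closed_Collect_eq continuous_intros) auto
  ultimately show ?thesis by (simp add: closed_Int_compact)
qed

lemma spca_value_attained:
  fixes \<Sigma> :: "real^'n^'n"
  assumes "1 \<le> k"
  shows "\<exists>x\<in>spca_feasible k. x \<bullet> (\<Sigma> *v x) = spca_value k \<Sigma> \<and>
    (\<forall>y\<in>spca_feasible k. y \<bullet> (\<Sigma> *v y) \<le> spca_value k \<Sigma>)"
proof -
  have "continuous_on (spca_feasible k) (\<lambda>x. x \<bullet> (\<Sigma> *v x))"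
    by (intro continuous_intros matrix_vector_mult_linear_continuous_on)
  then obtain x where x: "x \<in> spca_feasible k"
    "\<forall>y\<in>spca_feasible k. y \<bullet> (\<Sigma> *v y) \<le> x \<bullet> (\<Sigma> *v x)"
    using continuous_attains_sup[OF compact_spca_feasible spca_feasible_nonempty[OF assms]]
    by blast
  then have "spca_value k \<Sigma> = x \<bullet> (\<Sigma> *v x)"
    unfolding spca_value_def by (intro cSup_eq_maximum) auto
  with x show ?thesis by auto
qed

lemma inner_mult_eq_sum: "x \<bullet> (A *v x) = (\<Sum>i\<in>UNIV. \<Sum>j\<in>UNIV. x$i * A$i$j * x$j)"
  for A :: "real^'n^'n"
  by (simp add: inner_vec_def matrix_vector_mult_def sum_distrib_left mult.assoc)

lemma closed_psd: "closed {A :: real^'n^'n. psd A}"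
proof -
  have "{A :: real^'n^'n. psd A} =
     (\<Inter>i. \<Inter>j. {A. A$j$i = A$i$j}) \<inter>
     (\<Inter>x. {A. 0 \<le> (\<Sum>i\<in>UNIV. \<Sum>j\<in>UNIV. x$i * A$i$j * x$j)})"
    by (auto simp: psd_def sym_matrices_def transpose_def vec_eq_iff inner_mult_eq_sum)
  also have "closed \<dots>"
    by (intro closed_Int closed_INT ballI closed_Collect_eq closed_Collect_le continuous_intros)
  finally show ?thesis .
qed

lemma sdp_feasible_iff:
  "X \<in> sdp_feasible k \<longleftrightarrow> trace X = 1 \<and> psd X \<and> psd (real k *\<^sub>R diag_part X - X)"
  by (auto simp: sdp_feasible_def S_nk_def loewner_ge_def psd_def)

lemma closed_sdp_feasible: "closed (sdp_feasible k :: (real^'n^'n) set)"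
proof -
  have c: "continuous_on UNIV (\<lambda>X :: real^'n^'n. real k *\<^sub>R diag_part X - X)"
    unfolding diag_part_def
  proof (intro continuous_intros)
    fix i j :: 'n
    show "continuous_on UNIV (\<lambda>X :: real^'n^'n. if i = j then X $ i $ j else 0)"
      by (cases "i = j") (auto intro!: continuous_intros)
  qed
  have "closed {X :: real^'n^'n. psd (real k *\<^sub>R diag_part X - X)}"
    using closed_vimage[OF closed_psd c] by (simp add: vimage_def)
  moreover have "closed {X :: real^'n^'n. trace X = 1}"
    unfolding trace_def by (intro closed_Collect_eq continuous_intros)
  moreover have "(sdp_feasible k :: (real^'n^'n) set) =
      {X. trace X = 1} \<inter> {X. psd X} \<inter> {X. psd (real k *\<^sub>R diag_part X - X)}"
    by (auto simp: sdp_feasible_iff)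
  ultimately show ?thesis using closed_psd by (auto intro!: closed_Int)
qed

lemma inner_axis_mult_axis: "axis i 1 \<bullet> (A *v axis j 1) = A$i$j" for A :: "real^'n^'n"
  by (simp add: inner_axis' matrix_vector_mult_basis column_def)

lemma psd_entry_bound:
  fixes X :: "real^'n^'n"
  assumes "psd X"
  shows "\<bar>X$i$j\<bar> \<le> trace X"
proof -
  have ge: "0 \<le> x \<bullet> (X *v x)" for x using assms by (simp add: psd_def)
  have d: "0 \<le> X$l$l" for l using ge[of "axis l 1"] by (simp add: inner_axis_mult_axis)
  have sym: "X$j$i = X$i$j"
  proof -
    have "transpose X = X" using assms by (simp add: psd_def sym_matrices_def)
    then have "transpose X $ i $ j = X$i$j" by simp
    then show ?thesis by (simp add: transpose_def)
  qed
  have tr: "X$l$l \<le> trace X" for l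
    unfolding trace_def by (rule member_le_sum) (use d in auto)
  have "0 \<le> X$i$i + 2 * X$i$j + X$j$j"
    using ge[of "axis i 1 + axis j 1"] sym
    by (simp add: matrix_vector_right_distrib inner_add_left inner_add_right inner_axis_mult_axis)
  moreover have "0 \<le> X$i$i - 2 * X$i$j + X$j$j"
    using ge[of "axis i 1 - axis j 1"] sym
    by (simp add: matrix_vector_mult_diff_distrib inner_diff_left inner_diff_right
        inner_axis_mult_axis)
  ultimately show ?thesis using tr[of i] tr[of j] by linarith
qed

lemma compact_sdp_feasible: "compact (sdp_feasible k :: (real^'n^'n) set)"
proof -
  have "norm X \<le> real CARD('n) * real CARD('n)" if "X \<in> sdp_feasible k" for X :: "real^'n^'n"
  proof -
    have b: "\<bar>X$i$j\<bar> \<le> 1" for i j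
      using psd_entry_bound[of X i j] that by (simp add: sdp_feasible_iff)
    have "norm (X$i) \<le> real CARD('n)" for i
      using norm_le_l1_cart[of "X$i"] sum_bounded_above[of UNIV "\<lambda>j. \<bar>X$i$j\<bar>" 1] b by force
    then have "(\<Sum>i\<in>UNIV. norm (X$i)) \<le> real CARD('n) * real CARD('n)"
      using sum_bounded_above[of UNIV "\<lambda>i. norm (X$i)" "real CARD('n)"] by simp
    moreover have "norm X \<le> (\<Sum>i\<in>UNIV. norm (X$i))"
      by (simp add: norm_vec_def L2_set_le_sum)
    ultimately show ?thesis by simp
  qed
  then have "bounded (sdp_feasible k :: (real^'n^'n) set)"
    unfolding bounded_iff by blast
  then show ?thesis using closed_sdp_feasible by (simp add: compact_eq_bounded_closed)
qed

lemma psd_single: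
  assumes "0 \<le> c"
  shows "psd (\<chi> i j. if i = l \<and> j = l then c else 0 :: real^'n^'n)"
proof -
  have "x \<bullet> ((\<chi> i j. if i = l \<and> j = l then c else 0 :: real^'n^'n) *v x) = c * (x$l)\<^sup>2" for x
  proof -
    have "(\<Sum>j\<in>UNIV. x$i * (if i = l \<and> j = l then c else 0) * x$j)
        = (if i = l then c * (x$l)\<^sup>2 else 0)" for i
    proof (cases "i = l")
      case True
      have "(\<Sum>j\<in>UNIV. x$i * (if i = l \<and> j = l then c else 0) * x$j)
          = (\<Sum>j\<in>UNIV. if j = l then x$l * c * x$l else 0)"
        using True by (intro sum.cong) auto
      with True show ?thesis by (simp add: power2_eq_square)
    qed simp
    then show ?thesis by (simp add: inner_mult_eq_sum)
  qed
  with assms show ?thesis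
    by (auto simp: psd_def sym_matrices_def transpose_def vec_eq_iff)
qed

lemma sdp_feasible_nonempty:
  assumes "1 \<le> k"
  shows "(sdp_feasible k :: (real^'n^'n) set) \<noteq> {}"
proof -
  fix l :: 'n
  let ?E = "\<lambda>c. (\<chi> i j. if i = l \<and> j = l then c else 0) :: real^'n^'n"
  have "real k *\<^sub>R diag_part (?E 1) - ?E 1 = ?E (real k - 1)"
    by (auto simp: diag_part_def vec_eq_iff)
  moreover have "trace (?E 1) = 1" by (simp add: trace_def)
  ultimately have "?E 1 \<in> sdp_feasible k"
    using psd_single[of 1 l] psd_single[of "real k - 1" l] assms
    by (simp add: sdp_feasible_iff)
  then show ?thesis by blast
qed

lemma sdp_value_attained:
  fixes \<Sigma> :: "real^'n^'n"
  assumes "1 \<le> k"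
  shows "\<exists>X\<in>sdp_feasible k. frob \<Sigma> X = sdp_value k \<Sigma> \<and>
    (\<forall>Y\<in>sdp_feasible k. frob \<Sigma> Y \<le> sdp_value k \<Sigma>)"
proof -
  have "continuous_on (sdp_feasible k) (frob \<Sigma>)"
    unfolding frob_def trace_def transpose_def matrix_matrix_mult_def
    by (simp, intro continuous_intros)
  then obtain X where X: "X \<in> sdp_feasible k" "\<forall>Y\<in>sdp_feasible k. frob \<Sigma> Y \<le> frob \<Sigma> X"
    using continuous_attains_sup[OF compact_sdp_feasible sdp_feasible_nonempty[OF assms]]
    by blast
  then have "sdp_value k \<Sigma> = frob \<Sigma> X"
    unfolding sdp_value_def by (intro cSup_eq_maximum) auto
  with X show ?thesis by auto
qed

text \<open>Only for \<open>\<Sigma> = 0\<close> is the ratio of the optimal values a division by zero.\<close>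

lemma spca_value_pos:
  fixes \<Sigma> :: "real^'n^'n"
  assumes "1 \<le> k" "\<Sigma> \<succeq> 0" "\<Sigma> \<noteq> 0"
  shows "0 < spca_value k \<Sigma>"
proof -
  have p: "psd \<Sigma>" using assms(2) by (simp add: loewner_ge_def)
  obtain i j where "\<Sigma>$i$j \<noteq> 0" using assms(3) by (auto simp: vec_eq_iff)
  then have "0 < trace \<Sigma>" using psd_entry_bound[OF p, of i j] by linarith
  then obtain l where l: "0 < \<Sigma>$l$l"
    unfolding trace_def by (meson not_less sum_nonpos)
  have "(axis l 1 :: real^'n) \<in> spca_feasible k"
    using assms(1) by (simp add: spca_feasible_def l0_axis norm_axis_1)
  then have "axis l 1 \<bullet> (\<Sigma> *v axis l 1) \<le> spca_value k \<Sigma>"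
    using spca_value_attained[OF assms(1), of \<Sigma>] by blast
  then have "\<Sigma>$l$l \<le> spca_value k \<Sigma>" by (simp add: inner_axis_mult_axis)
  with l show ?thesis by simp
qed

end

theory Submission
  imports Defs
begin

text \<open>All three bounds come from writing a positive semidefinite matrix as a sum of
  \<open>rank\<close> many rank-one matrices \<open>u u\<^sup>T\<close>.

  Bound \<open>k\<close>: replacing \<open>X\<close> by the larger matrix \<open>k diag(X)\<close> leaves \<open>k\<close> times a convex combination
  of the diagonal entries of \<open>\<Sigma>\<close>.

  Bound \<open>n/k\<close>: the relaxation is at most the largest eigenvalue \<open>\<lambda>\<close>. If \<open>x\<close> is a unit
  eigenvector and \<open>y\<close> keeps its \<open>k\<close> largest entries, then \<open>\<lambda> |y|\<^sup>2 = y\<^sup>T \<Sigma> x\<close>, and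
  Cauchy--Schwarz for the form \<open>\<Sigma>\<close> gives \<open>y\<^sup>T \<Sigma> y \<ge> \<lambda> |y|\<^sup>4\<close>, where \<open>|y|\<^sup>2 \<ge> k/n\<close>.

  Bound \<open>r\<close>: the relaxation is tight for \<open>u u\<^sup>T\<close>. With \<open>z = X u\<close>, \<open>q = u\<^sup>T X u\<close> and
  \<open>\<tau>\<^sub>i = z\<^sub>i\<^sup>2 / (q X\<^sub>i\<^sub>i)\<close>, Cauchy--Schwarz gives \<open>q \<le> \<Sum> u\<^sub>i\<^sup>2 \<tau>\<^sub>i\<close>, the constraint \<open>X \<succeq> 0\<close> gives
  \<open>\<tau>\<^sub>i \<le> 1\<close>, and \<open>k diag(X) \<succeq> X\<close> gives \<open>\<Sum> \<tau>\<^sub>i \<le> k\<close>. So \<open>q\<close> is at most the sum of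
  the \<open>k\<close> largest \<open>u\<^sub>i\<^sup>2\<close>.\<close>

section \<open>Positive semidefinite forms\<close>

lemma psd_inner_commute:
  fixes A :: "real^'n^'n"
  assumes "psd A"
  shows "x \<bullet> (A *v y) = y \<bullet> (A *v x)"
proof -
  have "transpose A = A" using assms by (simp add: psd_def sym_matrices_def)
  then have "x \<bullet> (A *v y) = (A *v x) \<bullet> y"
    by (metis dot_lmul_matrix transpose_matrix_vector)
  then show ?thesis by (simp add: inner_commute)
qed

lemma psd_Cauchy_Schwarz:
  fixes A :: "real^'n^'n"
  assumes "psd A"
  shows "(x \<bullet> (A *v y))\<^sup>2 \<le> (x \<bullet> (A *v x)) * (y \<bullet> (A *v y))"
proof -
  define a b c where "a = x \<bullet> (A *v x)" and "b = x \<bullet> (A *v y)" and "c = y \<bullet> (A *v y)"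
  have pos: "0 \<le> z \<bullet> (A *v z)" for z using assms by (simp add: psd_def)
  have quad: "0 \<le> s\<^sup>2 * a - 2 * s * t * b + t\<^sup>2 * c" for s t
    using pos[of "s *\<^sub>R x - t *\<^sub>R y"] psd_inner_commute[OF assms, of y x]
    by (simp add: a_def b_def c_def matrix_vector_mult_diff_distrib matrix_vector_mult_scaleR
        inner_diff_left inner_diff_right algebra_simps power2_eq_square)
  have "b\<^sup>2 \<le> a * c"
  proof (cases "c = 0")
    case True
    have "b = 0"
    proof (rule ccontr)
      assume "b \<noteq> 0"
      \<comment> \<open>With \<open>c = 0\<close> and \<open>s = 1\<close> the form is affine in
        \<open>t\<close>, and this \<open>t\<close> brings it to \<open>-1\<close>.\<close>
      then show False using quad[of 1 "(a + 1) / (2 * b)"] True by simp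
    qed
    with True show ?thesis by simp
  next
    case False
    then have "0 < c" using pos[of y] by (simp add: c_def)
    \<comment> \<open>For \<open>s = 1\<close> the quadratic is least at \<open>t = b / c\<close>;
      scaling both by \<open>c\<close> avoids the division.\<close>
    moreover have "0 \<le> c * (a * c - b\<^sup>2)"
      using quad[of c b] by (simp add: algebra_simps power2_eq_square)
    ultimately show ?thesis by (simp add: zero_le_mult_iff)
  qed
  then show ?thesis by (simp add: a_def b_def c_def)
qed

lemma psd_diag_nonneg: "psd A \<Longrightarrow> 0 \<le> A$i$i"
  unfolding psd_def by (metis inner_axis_mult_axis)

section \<open>Rank-one matrices and decomposition into them\<close>

definition outer :: "real^'n \<Rightarrow> real^'n^'n" where
  "outer u = (\<chi> i j. u$i * u$j)"

lemma outer_mult_vec: "outer u *v x = (u \<bullet> x) *\<^sub>R u"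
  by (simp add: outer_def vec_eq_iff matrix_vector_mult_def inner_vec_def sum_distrib_left
      sum_distrib_right mult_ac)

lemma frob_eq_sum: "frob A B = (\<Sum>i\<in>UNIV. \<Sum>j\<in>UNIV. A$i$j * B$i$j)"
  unfolding frob_def trace_def
  by (subst sum.swap) (simp add: matrix_matrix_mult_def transpose_def mult.commute)

lemma frob_commute: "frob A B = frob B A"
  by (simp add: frob_eq_sum mult.commute)

lemma frob_sum_left: "frob (\<Sum>l\<in>L. F l) B = (\<Sum>l\<in>L. frob (F l) B)"
  by (induction L rule: infinite_finite_induct)
    (simp_all add: frob_eq_sum distrib_right sum.distrib)

lemma frob_outer: "frob (outer u) X = u \<bullet> (X *v u)"
  by (simp add: frob_eq_sum inner_mult_eq_sum outer_def mult_ac)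

lemma trace_sum_outer: "trace (\<Sum>l\<in>L. outer (U l)) = (\<Sum>l\<in>L. U l \<bullet> U l)"
  by (induction L rule: infinite_finite_induct)
    (simp_all add: trace_add, simp_all add: trace_def outer_def inner_vec_def)

text \<open>A Cholesky step: subtracting a suitable \<open>outer u\<close> keeps the matrix positive
  semidefinite and strictly shrinks its range, so induction on the rank produces at most
  \<open>rank A\<close> terms.\<close>

lemma psd_outer_decomposition:
  fixes A :: "real^'n^'n"
  assumes "psd A"
  shows "\<exists>m U. m \<le> rank A \<and> A = (\<Sum>l<m. outer (U l))"
  using assms
proof (induction "rank A" arbitrary: A rule: less_induct)
  case less
  show ?case
  proof (cases "A = 0")
    case True
    then show ?thesis by (intro exI[of _ 0]) simp
  next
    case False
    then obtain i j where "A$i$j \<noteq> 0" by (auto simp: vec_eq_iff)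
    \<comment> \<open>Entries are bounded by the trace, so a nonzero matrix has a positive diagonal
      entry to serve as pivot.\<close>
    then have "0 < trace A" using psd_entry_bound[OF less.prems, of i j] by linarith
    then obtain i where i: "0 < A$i$i"
      unfolding trace_def by (meson not_less sum_nonpos)
    define e :: "real^'n" where "e = axis i 1"
    define d where "d = A$i$i"
    \<comment> \<open>The pivot column, scaled so that \<open>outer u\<close> agrees with
      \<open>A\<close> on \<open>e\<close>.\<close>
    define u where "u = (1 / sqrt d) *\<^sub>R (A *v e)"
    define B where "B = A - outer u"
    have d: "0 < d" "e \<bullet> (A *v e) = d"
      using i by (simp_all add: d_def e_def inner_axis_mult_axis)
    have ux: "u \<bullet> x = (x \<bullet> (A *v e)) / sqrt d" for x
      by (simp add: u_def inner_commute)
    have Bx: "B *v x = A *v x - (u \<bullet> x) *\<^sub>R u" for x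
      by (simp add: B_def matrix_vector_mult_diff_rdistrib outer_mult_vec)
    have ui: "u \<bullet> e = sqrt d" using d by (simp add: ux real_div_sqrt)
    have Be: "B *v e = 0" using d(1) by (simp add: Bx ui) (simp add: u_def)
    have "psd B" unfolding psd_def
    proof (intro conjI allI)
      show "B \<in> sym_matrices" using less.prems
        by (auto simp: psd_def sym_matrices_def B_def outer_def transpose_def vec_eq_iff mult.commute)
      fix x
      have "(u \<bullet> x)\<^sup>2 \<le> x \<bullet> (A *v x)"
        using psd_Cauchy_Schwarz[OF less.prems, of x e] d
        by (simp add: ux power_divide pos_divide_le_eq)
      then show "0 \<le> x \<bullet> (B *v x)"
        by (simp add: Bx inner_diff_right power2_eq_square inner_commute)
    qed
    have "range ((*v) B) \<subset> range ((*v) A)"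
    proof
      show "range ((*v) B) \<subseteq> range ((*v) A)"
      proof
        fix y assume "y \<in> range ((*v) B)"
        then obtain x where "y = B *v x" by blast
        then have "y = A *v (x - ((u \<bullet> x) / sqrt d) *\<^sub>R e)"
          by (simp add: Bx u_def matrix_vector_mult_diff_distrib matrix_vector_mult_scaleR)
        then show "y \<in> range ((*v) A)" by blast
      qed
      \<comment> \<open>Since \<open>B\<close> is symmetric and \<open>B *v e = 0\<close>, its range
        is orthogonal to \<open>e\<close>, while \<open>A *v e\<close> is not.\<close>
      have "A *v e \<notin> range ((*v) B)"
      proof
        assume "A *v e \<in> range ((*v) B)"
        then obtain x where "A *v e = B *v x" by blast
        then have "d = e \<bullet> (B *v x)" using d by simp
        also have "\<dots> = 0" using psd_inner_commute[OF \<open>psd B\<close>, of e x] Be by simp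
        finally show False using d by simp
      qed
      then show "range ((*v) B) \<noteq> range ((*v) A)" by blast
    qed
    moreover have span: "span (range ((*v) C)) = range ((*v) C)" for C :: "real^'n^'n"
      by (simp add: linear_subspace_image)
    ultimately have rk: "rank B < rank A"
      unfolding rank_dim_range by (intro dim_psubset) (simp only: span)
    then obtain m U where mU: "m \<le> rank B" "B = (\<Sum>l<m. outer (U l))"
      using less.hyps[OF _ \<open>psd B\<close>] by blast
    have "(\<Sum>l<Suc m. outer ((U(m := u)) l)) = B + outer u"
      unfolding mU(2) by simp
    also have "\<dots> = A" by (simp add: B_def)
    finally have "A = (\<Sum>l<Suc m. outer ((U(m := u)) l))" ..
    moreover have "Suc m \<le> rank A" using mU(1) rk by simp
    ultimately show ?thesis by blast
  qed
qed

section \<open>Selecting the largest values\<close>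

lemma exists_top_subset:
  fixes a :: "'a::finite \<Rightarrow> real"
  assumes "k \<le> CARD('a)"
  shows "\<exists>S. card S = k \<and> (\<forall>i\<in>S. \<forall>j\<in>-S. a j \<le> a i)"
  using assms
proof (induction k)
  case 0
  then show ?case by (intro exI[of _ "{}"]) simp
next
  case (Suc k)
  then obtain S where S: "card S = k" "\<forall>i\<in>S. \<forall>j\<in>-S. a j \<le> a i" by auto
  have "S \<noteq> UNIV" using S(1) Suc.prems by auto
  then have "Max (a ` (- S)) \<in> a ` (- S)" by (intro Max_in) auto
  then obtain m where "m \<in> - S" "Max (a ` (- S)) = a m" by blast
  then have "m \<in> - S" "\<forall>j\<in>-S. a j \<le> a m"
    using Max_ge[of "a ` (- S)"] by auto
  with S show ?case by (intro exI[of _ "insert m S"]) auto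
qed

text \<open>Exchange argument: since the total weight is at most \<open>k = card S\<close>, the
  weight outside a top set \<open>S\<close> fits into the slack \<open>1 - \<tau> i\<close> inside
  it. A unit of weight is worth at most the threshold \<open>\<theta>\<close> outside
  \<open>S\<close> and at least \<open>\<theta>\<close> inside.\<close>

lemma fractional_knapsack:
  fixes a \<tau> :: "'a::finite \<Rightarrow> real"
  assumes "1 \<le> k" "k \<le> CARD('a)"
    and "\<And>i. 0 \<le> a i" "\<And>i. 0 \<le> \<tau> i" "\<And>i. \<tau> i \<le> 1" "(\<Sum>i\<in>UNIV. \<tau> i) \<le> real k"
  shows "\<exists>S. card S = k \<and> (\<Sum>i\<in>UNIV. a i * \<tau> i) \<le> (\<Sum>i\<in>S. a i)"
proof -
  obtain S where S: "card S = k" "\<forall>i\<in>S. \<forall>j\<in>-S. a j \<le> a i"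
    using exists_top_subset[OF assms(2)] by blast
  define \<theta> where "\<theta> = Min (a ` S)"
  have "S \<noteq> {}" using S(1) assms(1) by auto
  then have "\<theta> \<in> a ` S" unfolding \<theta>_def by (intro Min_in) auto
  then have \<theta>: "0 \<le> \<theta>" "\<And>i. i \<in> S \<Longrightarrow> \<theta> \<le> a i" "\<And>j. j \<notin> S \<Longrightarrow> a j \<le> \<theta>"
    using S(2) assms(3) by (auto simp: \<theta>_def)
  have split: "(\<Sum>i\<in>UNIV. f i) = (\<Sum>i\<in>S. f i) + (\<Sum>i\<in>-S. f i)" for f :: "'a \<Rightarrow> real"
    by (metis Compl_eq_Diff_UNIV finite subset_UNIV sum.subset_diff add.commute)
  have "(\<Sum>i\<in>S. \<theta> * (1 - \<tau> i)) \<le> (\<Sum>i\<in>S. a i * (1 - \<tau> i))"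
    by (intro sum_mono mult_right_mono) (use \<theta> assms(5) in auto)
  moreover have "(\<Sum>i\<in>-S. a i * \<tau> i) \<le> (\<Sum>i\<in>-S. \<theta> * \<tau> i)"
    by (intro sum_mono mult_right_mono) (use \<theta> assms(4) in auto)
  moreover have "(\<Sum>i\<in>-S. \<theta> * \<tau> i) \<le> (\<Sum>i\<in>S. \<theta> * (1 - \<tau> i))"
  proof -
    have "(\<Sum>i\<in>-S. \<tau> i) \<le> (\<Sum>i\<in>S. 1 - \<tau> i)"
      using assms(6) split[of \<tau>] S(1) by (simp add: sum_subtractf)
    then show ?thesis
      using \<theta>(1) by (simp add: mult_left_mono flip: sum_distrib_left)
  qed
  ultimately have "(\<Sum>i\<in>-S. a i * \<tau> i) \<le> (\<Sum>i\<in>S. a i * (1 - \<tau> i))" by linarith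
  then have "(\<Sum>i\<in>UNIV. a i * \<tau> i) \<le> (\<Sum>i\<in>S. a i)"
    by (simp add: split[of "\<lambda>i. a i * \<tau> i"] right_diff_distrib sum_subtractf)
  with S(1) show ?thesis by blast
qed

section \<open>Quadratic forms on sparse vectors\<close>

text \<open>Normalising once here lets the later bounds use truncated vectors of any length.\<close>

lemma quadratic_form_le_spca_value:
  fixes \<Sigma> :: "real^'n^'n"
  assumes "1 \<le> k" "l0 x \<le> k"
  shows "x \<bullet> (\<Sigma> *v x) \<le> spca_value k \<Sigma> * (x \<bullet> x)"
proof (cases "x = 0")
  case False
  define y where "y = (1 / norm x) *\<^sub>R x"
  have "l0 y = l0 x" using False by (simp add: y_def l0_def)
  then have "y \<in> spca_feasible k"
    using assms(2) False by (simp add: spca_feasible_def y_def)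
  then have "y \<bullet> (\<Sigma> *v y) \<le> spca_value k \<Sigma>"
    using spca_value_attained[OF assms(1)] by blast
  moreover have "y \<bullet> (\<Sigma> *v y) = (x \<bullet> (\<Sigma> *v x)) / (x \<bullet> x)"
    by (simp add: y_def matrix_vector_mult_scaleR flip: power2_norm_eq_inner)
      (simp add: power2_eq_square)
  ultimately show ?thesis using False by (simp add: pos_divide_le_eq)
qed simp

definition restrict_vec :: "'n set \<Rightarrow> real^'n \<Rightarrow> real^'n" where
  "restrict_vec S x = (\<chi> i. if i \<in> S then x$i else 0)"

lemma l0_restrict_vec: "l0 (restrict_vec S x) \<le> card S"
  unfolding l0_def restrict_vec_def by (intro card_mono) auto

lemma inner_restrict_vec:
  "restrict_vec S x \<bullet> x = (\<Sum>i\<in>S. (x$i)\<^sup>2)"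
  "restrict_vec S x \<bullet> restrict_vec S x = (\<Sum>i\<in>S. (x$i)\<^sup>2)"
  by (simp_all add: inner_vec_def restrict_vec_def power2_eq_square if_distrib if_distribR
      sum.If_cases cong: if_cong)

section \<open>Tightness for rank-one objectives\<close>

lemma psd_quadratic_form_le_sparse:
  fixes X :: "real^'n^'n"
  assumes k: "1 \<le> k" "k \<le> CARD('n)" and X: "X \<in> sdp_feasible k"
  shows "\<exists>S. card S = k \<and> u \<bullet> (X *v u) \<le> (\<Sum>i\<in>S. (u$i)\<^sup>2)"
proof -
  have pX: "psd X" and pD: "psd (real k *\<^sub>R diag_part X - X)" and tr: "trace X = 1"
    using X by (auto simp: sdp_feasible_iff)
  define q z where "q = u \<bullet> (X *v u)" and "z = X *v u"
  \<comment> \<open>Where \<open>X$i$i = 0\<close> also \<open>z$i = 0\<close>, by \<open>z2\<close>, and the junk value \<open>0 / 0 = 0\<close> is the right one.\<close>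
  define \<tau> where "\<tau> i = (z$i)\<^sup>2 / (q * X$i$i)" for i
  define y :: "real^'n" where "y = (\<chi> i. z$i / X$i$i)"
  have q: "0 \<le> q" using pX by (simp add: q_def psd_def)
  have d: "0 \<le> X$i$i" for i using pX by (rule psd_diag_nonneg)
  have z2: "(z$i)\<^sup>2 \<le> X$i$i * q" for i
    using psd_Cauchy_Schwarz[OF pX, of "axis i 1" u]
    by (simp add: z_def q_def inner_axis_mult_axis) (simp add: inner_axis')
  have z0: "z$i = 0" if "X$i$i = 0" for i using z2[of i] that by simp
  have "\<tau> i \<le> 1" for i
  proof (cases "q * X$i$i = 0")
    case False
    then have "0 < q * X$i$i" using q d[of i] by auto
    then show ?thesis using z2[of i] by (simp add: \<tau>_def mult.commute)
  qed (auto simp: \<tau>_def)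
  moreover have "0 \<le> \<tau> i" for i using q d[of i] by (simp add: \<tau>_def)
  \<comment> \<open>If \<open>q = 0\<close>, division by zero makes every \<open>\<tau> i\<close>
    zero, so this bound and the later one on \<open>q\<close> are trivial.\<close>
  moreover have "(\<Sum>i\<in>UNIV. \<tau> i) \<le> real k"
  proof (cases "q = 0")
    case False
    \<comment> \<open>\<open>T\<close> is \<open>q\<close> times the sum of the
      \<open>\<tau> i\<close>. Testing \<open>k diag(X) - X\<close> on \<open>y\<close>, which is
      \<open>z\<close> divided by the diagonal, bounds \<open>y \<bullet> (X *v y)\<close> by
      \<open>k * T\<close>; Cauchy--Schwarz against \<open>u\<close> then yields
      \<open>T\<^sup>2 \<le> k * T * q\<close>.\<close>
    define T where "T = (\<Sum>i\<in>UNIV. (z$i)\<^sup>2 / X$i$i)"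
    have T0: "0 \<le> T" unfolding T_def using d by (intro sum_nonneg) auto
    have yz: "y \<bullet> (X *v u) = T"
      by (simp add: T_def y_def inner_vec_def power2_eq_square flip: z_def)
    have "diag_part X *v y = z"
    proof -
      have "(diag_part X *v y) $ i = z $ i" for i
      proof -
        have "(diag_part X *v y) $ i = (\<Sum>j\<in>UNIV. if j = i then X$i$i * y$i else 0)"
          unfolding matrix_vector_mult_def diag_part_def vec_lambda_beta
          by (rule sum.cong) auto
        then show ?thesis using z0[of i] by (simp add: y_def)
      qed
      then show ?thesis by (simp add: vec_eq_iff)
    qed
    then have "y \<bullet> ((real k *\<^sub>R diag_part X - X) *v y) = real k * T - y \<bullet> (X *v y)"
      using yz by (simp add: matrix_vector_mult_diff_rdistrib inner_diff_right z_def
          flip: scaleR_matrix_vector_assoc)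
    moreover have "0 \<le> y \<bullet> ((real k *\<^sub>R diag_part X - X) *v y)"
      using pD unfolding psd_def by blast
    ultimately have "y \<bullet> (X *v y) \<le> k * T" by linarith
    then have "(y \<bullet> (X *v y)) * q \<le> (k * T) * q" using q by (rule mult_right_mono)
    then have "T\<^sup>2 \<le> (k * T) * q"
      using psd_Cauchy_Schwarz[OF pX, of y u] unfolding yz q_def by (rule order_trans[rotated])
    then have "T \<le> k * q"
      using T0 q by (cases "T = 0") (auto simp: power2_eq_square mult_ac)
    moreover have "(\<Sum>i\<in>UNIV. \<tau> i) = T / q"
      by (simp add: \<tau>_def T_def sum_divide_distrib mult.commute)
    ultimately show ?thesis using q False by (simp add: pos_divide_le_eq)
  qed (simp add: \<tau>_def)
  ultimately obtain S where S: "card S = k"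
    "(\<Sum>i\<in>UNIV. (u$i)\<^sup>2 * \<tau> i) \<le> (\<Sum>i\<in>S. (u$i)\<^sup>2)"
    using fractional_knapsack[OF k, of "\<lambda>i. (u$i)\<^sup>2" \<tau>] by auto
  have "q \<le> (\<Sum>i\<in>UNIV. (u$i)\<^sup>2 * \<tau> i)"
  proof (cases "q = 0")
    case False
    \<comment> \<open>Splitting off \<open>sqrt (X$i$i)\<close> turns the first Cauchy--Schwarz
      factor into the trace, which is 1.\<close>
    have "q = (\<Sum>i\<in>UNIV. sqrt (X$i$i) * (u$i * z$i / sqrt (X$i$i)))"
      unfolding q_def inner_vec_def z_def[symmetric]
    proof (rule sum.cong)
      fix i show "u$i \<bullet> z$i = sqrt (X$i$i) * (u$i * z$i / sqrt (X$i$i))"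
        using z0[of i] by (cases "X$i$i = 0") simp_all
    qed simp
    then have "q\<^sup>2 = (\<Sum>i\<in>UNIV. sqrt (X$i$i) * (u$i * z$i / sqrt (X$i$i)))\<^sup>2"
      by (rule arg_cong)
    also have "\<dots> \<le> (\<Sum>i\<in>UNIV. (sqrt (X$i$i))\<^sup>2) * (\<Sum>i\<in>UNIV. (u$i * z$i / sqrt (X$i$i))\<^sup>2)"
      by (rule Cauchy_Schwarz_ineq_sum)
    also have "\<dots> = (\<Sum>i\<in>UNIV. (u$i * z$i / sqrt (X$i$i))\<^sup>2)"
      using tr d by (simp add: trace_def)
    also have "\<dots> = q * (\<Sum>i\<in>UNIV. (u$i)\<^sup>2 * \<tau> i)"
      using d False by (simp add: sum_distrib_left \<tau>_def power_divide power_mult_distrib)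
    finally show ?thesis using q False by (simp add: power2_eq_square)
  qed (use q in \<open>simp add: \<tau>_def\<close>)
  then have "q \<le> (\<Sum>i\<in>S. (u$i)\<^sup>2)" using S(2) by linarith
  with S(1) show ?thesis unfolding q_def by blast
qed

section \<open>The bound \<open>k\<close>\<close>

lemma frob_le_k_spca_value:
  fixes \<Sigma> :: "real^'n^'n"
  assumes k: "1 \<le> k" and \<Sigma>: "psd \<Sigma>" and X: "X \<in> sdp_feasible k"
  shows "frob \<Sigma> X \<le> real k * spca_value k \<Sigma>"
proof -
  obtain m U where U: "\<Sigma> = (\<Sum>l<(m::nat). outer (U l))"
    using psd_outer_decomposition[OF \<Sigma>] by blast
  have pX: "psd X" and pD: "psd (real k *\<^sub>R diag_part X - X)" and tr: "trace X = 1"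
    using X by (auto simp: sdp_feasible_iff)
  have diag: "\<Sigma>$i$i \<le> spca_value k \<Sigma>" for i
    using quadratic_form_le_spca_value[OF k, of "axis i 1" \<Sigma>] k
    by (simp add: l0_axis inner_axis_mult_axis inner_axis_axis)
  have "frob \<Sigma> X = (\<Sum>l<m. U l \<bullet> (X *v U l))"
    unfolding U frob_sum_left frob_outer ..
  \<comment> \<open>Decomposing \<open>\<Sigma>\<close> reduces the comparison of traces to the
    Loewner constraint tested on each \<open>U l\<close>.\<close>
  also have "\<dots> \<le> (\<Sum>l<m. U l \<bullet> ((real k *\<^sub>R diag_part X) *v U l))"
    using pD by (intro sum_mono) (simp add: psd_def matrix_vector_mult_diff_rdistrib inner_diff_right)
  also have "\<dots> = frob \<Sigma> (real k *\<^sub>R diag_part X)"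
    unfolding U frob_sum_left frob_outer ..
  also have "\<dots> = real k * (\<Sum>i\<in>UNIV. \<Sigma>$i$i * X$i$i)"
    by (simp add: frob_eq_sum diag_part_def sum_distrib_left if_distrib mult_ac cong: if_cong)
  also have "\<dots> \<le> real k * (\<Sum>i\<in>UNIV. spca_value k \<Sigma> * X$i$i)"
    using diag psd_diag_nonneg[OF pX] by (intro mult_left_mono sum_mono mult_right_mono) auto
  also have "\<dots> = real k * spca_value k \<Sigma>"
    using tr by (simp add: trace_def flip: sum_distrib_left)
  finally show ?thesis .
qed

section \<open>The bound \<open>n/k\<close> through the largest eigenvalue\<close>

text \<open>With \<open>k = n\<close> the sparsity constraint is void, so \<open>spca_value n \<Sigma>\<close> is the largest
  eigenvalue of \<open>\<Sigma>\<close>.\<close>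

lemma quadratic_form_le_max_eigenvalue:
  fixes \<Sigma> :: "real^'n^'n"
  shows "x \<bullet> (\<Sigma> *v x) \<le> spca_value CARD('n) \<Sigma> * (x \<bullet> x)"
  by (rule quadratic_form_le_spca_value) (auto simp: l0_def card_mono Suc_leI)

text \<open>Here \<open>X\<close> is the matrix decomposed: the squared lengths of the
  \<open>U l\<close> sum to its trace 1, so the objective is a weighted average of Rayleigh
  quotients of \<open>\<Sigma>\<close>.\<close>

lemma frob_le_max_eigenvalue:
  fixes \<Sigma> :: "real^'n^'n"
  assumes "X \<in> sdp_feasible k"
  shows "frob \<Sigma> X \<le> spca_value CARD('n) \<Sigma>"
proof -
  have pX: "psd X" and tr: "trace X = 1" using assms by (auto simp: sdp_feasible_iff)
  obtain m U where U: "X = (\<Sum>l<(m::nat). outer (U l))"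
    using psd_outer_decomposition[OF pX] by blast
  have "frob \<Sigma> X = (\<Sum>l<m. U l \<bullet> (\<Sigma> *v U l))"
    unfolding frob_commute[of \<Sigma>] U frob_sum_left frob_outer ..
  also have "\<dots> \<le> (\<Sum>l<m. spca_value CARD('n) \<Sigma> * (U l \<bullet> U l))"
    by (intro sum_mono quadratic_form_le_max_eigenvalue)
  also have "\<dots> = spca_value CARD('n) \<Sigma> * trace X"
    by (simp add: U trace_sum_outer sum_distrib_left)
  finally show ?thesis using tr by simp
qed

lemma max_eigenvalue_le_spca_value:
  fixes \<Sigma> :: "real^'n^'n"
  assumes k: "1 \<le> k" "k \<le> CARD('n)" and \<Sigma>: "psd \<Sigma>" "\<Sigma> \<noteq> 0"
  shows "spca_value CARD('n) \<Sigma> \<le> real CARD('n) / real k * spca_value k \<Sigma>"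
proof -
  define \<mu> where "\<mu> = spca_value CARD('n) \<Sigma>"
  have n: "1 \<le> CARD('n)" using k by simp
  have \<mu>: "0 < \<mu>"
    unfolding \<mu>_def using \<Sigma> n by (intro spca_value_pos) (simp_all add: loewner_ge_def)
  obtain x where x: "x \<in> spca_feasible CARD('n)" "x \<bullet> (\<Sigma> *v x) = \<mu>"
    using spca_value_attained[OF n] unfolding \<mu>_def by blast
  then have xx: "x \<bullet> x = 1" by (simp add: spca_feasible_def power2_norm_eq_inner)
  define M where "M = \<mu> *\<^sub>R mat 1 - \<Sigma>"
  have M: "M *v v = \<mu> *\<^sub>R v - \<Sigma> *v v" for v
    by (simp add: M_def matrix_vector_mult_diff_rdistrib flip: scaleR_matrix_vector_assoc)
  have "psd M"
    using \<Sigma>(1) quadratic_form_le_max_eigenvalue[of _ \<Sigma>]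
    by (auto simp: psd_def M inner_diff_right \<mu>_def)
      (auto simp: M_def sym_matrices_def transpose_def vec_eq_iff mat_def)
  \<comment> \<open>The form of \<open>M\<close> vanishes at the maximiser \<open>x\<close>, so
    Cauchy--Schwarz makes \<open>M *v x\<close> orthogonal to every \<open>v\<close>:
    \<open>x\<close> is an eigenvector.\<close>
  have eig: "v \<bullet> (\<Sigma> *v x) = \<mu> * (v \<bullet> x)" for v
    using psd_Cauchy_Schwarz[OF \<open>psd M\<close>, of v x] x xx by (simp add: M inner_diff_right)
  \<comment> \<open>Constant weights \<open>k/n\<close> in the knapsack bound give \<open>k\<close>
    coordinates carrying at least the fraction \<open>k/n\<close> of the squared norm.\<close>
  have "(\<Sum>i\<in>(UNIV::'n set). real k / real CARD('n)) = real k" by simp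
  then obtain S where S: "card S = k"
    "(\<Sum>i\<in>UNIV. (x$i)\<^sup>2 * (real k / real CARD('n))) \<le> (\<Sum>i\<in>S. (x$i)\<^sup>2)"
    using fractional_knapsack[OF k, of "\<lambda>i. (x$i)\<^sup>2" "\<lambda>_. real k / real CARD('n)"] k by auto
  define y s where "y = restrict_vec S x" and "s = (\<Sum>i\<in>S. (x$i)\<^sup>2)"
  have ys: "y \<bullet> x = s" "y \<bullet> y = s" by (simp_all add: y_def s_def inner_restrict_vec)
  have "(\<Sum>i\<in>UNIV. (x$i)\<^sup>2) = 1" using xx by (simp add: inner_vec_def power2_eq_square)
  then have ks: "real k / real CARD('n) \<le> s"
    using S(2) by (simp only: s_def flip: sum_distrib_right)
  moreover have "0 < real k / real CARD('n)" using k by simp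
  ultimately have s: "0 < s" by linarith
  have "(\<mu> * s)\<^sup>2 \<le> (y \<bullet> (\<Sigma> *v y)) * \<mu>"
    using psd_Cauchy_Schwarz[OF \<Sigma>(1), of y x] by (simp add: eig ys xx)
  also have "\<dots> \<le> (spca_value k \<Sigma> * s) * \<mu>"
    using quadratic_form_le_spca_value[OF k(1), of y \<Sigma>] l0_restrict_vec[of S x] S(1) \<mu> ys
    by (intro mult_right_mono) (auto simp: y_def)
  finally have "\<mu> * s \<le> spca_value k \<Sigma>"
    using \<mu> s by (simp add: power2_eq_square mult_ac)
  moreover have "\<mu> * (real k / real CARD('n)) \<le> \<mu> * s" using ks \<mu> by (intro mult_left_mono) auto
  ultimately have "\<mu> * (real k / real CARD('n)) \<le> spca_value k \<Sigma>" by linarith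
  then show ?thesis using k by (simp add: \<mu>_def field_simps)
qed

section \<open>The bound \<open>r\<close>\<close>

lemma frob_le_rank_spca_value:
  fixes \<Sigma> :: "real^'n^'n"
  assumes k: "1 \<le> k" "k \<le> CARD('n)" and \<Sigma>: "psd \<Sigma>" "\<Sigma> \<noteq> 0" and X: "X \<in> sdp_feasible k"
  shows "frob \<Sigma> X \<le> real (rank \<Sigma>) * spca_value k \<Sigma>"
proof -
  have v: "0 < spca_value k \<Sigma>"
    using \<Sigma> k by (intro spca_value_pos) (simp_all add: loewner_ge_def)
  obtain m U where m: "m \<le> rank \<Sigma>" and U: "\<Sigma> = (\<Sum>l<m. outer (U l))"
    using psd_outer_decomposition[OF \<Sigma>(1)] by blast
  have "U l \<bullet> (X *v U l) \<le> spca_value k \<Sigma>" if l: "l < m" for l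
  proof -
    obtain S where S: "card S = k" "U l \<bullet> (X *v U l) \<le> (\<Sum>i\<in>S. (U l $ i)\<^sup>2)"
      using psd_quadratic_form_le_sparse[OF k X] by blast
    define y s where "y = restrict_vec S (U l)" and "s = (\<Sum>i\<in>S. (U l $ i)\<^sup>2)"
    have ys: "y \<bullet> U l = s" "y \<bullet> y = s" by (simp_all add: y_def s_def inner_restrict_vec)
    have s0: "0 \<le> s" unfolding s_def by (intro sum_nonneg) simp
    \<comment> \<open>The \<open>l\<close>-th summand of \<open>\<Sigma>\<close> alone contributes
      \<open>s\<^sup>2\<close> to the form at \<open>y\<close>; the others only add squares.\<close>
    have "s\<^sup>2 \<le> (\<Sum>j<m. (y \<bullet> U j)\<^sup>2)"
      using member_le_sum[of l "{..<m}" "\<lambda>j. (y \<bullet> U j)\<^sup>2"] l by (simp add: ys)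
    also have "\<dots> = y \<bullet> (\<Sigma> *v y)"
      unfolding frob_outer[symmetric] frob_commute[of "outer y"] U frob_sum_left
      by (simp add: frob_outer outer_mult_vec power2_eq_square inner_commute)
    also have "\<dots> \<le> spca_value k \<Sigma> * s"
      using quadratic_form_le_spca_value[OF k(1), of y \<Sigma>] l0_restrict_vec[of S "U l"] S(1) ys
      by (auto simp: y_def)
    finally have "s \<le> spca_value k \<Sigma>"
      using s0 v by (cases "s = 0") (auto simp: power2_eq_square)
    with S(2) show ?thesis by (simp add: s_def)
  qed
  then have "(\<Sum>l<m. U l \<bullet> (X *v U l)) \<le> real m * spca_value k \<Sigma>"
    using sum_bounded_above[of "{..<m}" "\<lambda>l. U l \<bullet> (X *v U l)"] by simp
  moreover have "frob \<Sigma> X = (\<Sum>l<m. U l \<bullet> (X *v U l))"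
    unfolding U frob_sum_left frob_outer ..
  moreover have "real m * spca_value k \<Sigma> \<le> real (rank \<Sigma>) * spca_value k \<Sigma>"
    using m v by (intro mult_right_mono) auto
  ultimately show ?thesis by linarith
qed

theorem theorem4p1:
  fixes \<Sigma> :: "real^'n^'n" and k :: nat
  assumes "1 \<le> k" and "k \<le> CARD('n)"
    and "\<Sigma> \<in> sym_matrices" and "\<Sigma> \<succeq> 0"
  shows "sdp_value k \<Sigma> / spca_value k \<Sigma>
    \<le> Min {real k, real CARD('n) / real k, real (rank \<Sigma>)}"
proof -
  have \<Sigma>: "psd \<Sigma>" using assms(4) by (simp add: loewner_ge_def)
  obtain X where X: "X \<in> sdp_feasible k" "frob \<Sigma> X = sdp_value k \<Sigma>"
    using sdp_value_attained[OF assms(1)] by blast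
  show ?thesis
  proof (cases "\<Sigma> = 0")
    \<comment> \<open>The numerator vanishes, so the ratio is 0 whatever the denominator, and all
      three bounds are nonnegative.\<close>
    case True
    then have "sdp_value k \<Sigma> = 0" using X(2) by (simp add: frob_eq_sum)
    then show ?thesis by simp
  next
    case False
    have "0 < spca_value k \<Sigma>" using spca_value_pos[OF assms(1,4) False] .
    then show ?thesis
      using frob_le_k_spca_value[OF assms(1) \<Sigma> X(1)]
        frob_le_rank_spca_value[OF assms(1,2) \<Sigma> False X(1)]
        order_trans[OF frob_le_max_eigenvalue[OF X(1)]
          max_eigenvalue_le_spca_value[OF assms(1,2) \<Sigma> False]]
      unfolding X(2) by (simp add: pos_divide_le_eq)
  qed
qed

end
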